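(* The unbiased binary (i.e. $2$-ary) black-box complexity of $\textsc{LeadingOnes}_n$ is $O(n\log n)$; that is, there is a constant $C$ such that for all integers $n\ge 2$ the unbiased $2$-ary black-box complexity of $\textsc{LeadingOnes}_n$ is at most $C\,n\log n$.
   Context: $[n]=\{1,\ldots,n\}$ and $[0..n]=[n]\cup\{0\}$. Unbiased operators. Let $n,k\in\mathbb{N}$ be positive integers. For $\sigma\in S_n$ (a permutation of $[n]$) and $x\in\{0,1\}^n$ write $\sigma(x):=x_{\sigma(1)}\cdots x_{\sigma(n)}$; $\oplus$ is bitwise exclusive-or. An unbiased $k$-ary variation operator on $\{0,1\}^n$ is a randomized operator which on input $(x^1,\ldots,x^k)\in(\{0,1\}^n)^k$ samples its output according to a conditional distribution $D(\cdot\mid x^1,\ldots,x^k)$ on $\{0,1\}^n$ such that for all $x^1,\ldots,x^k,y,z\in\{0,1\}^n$ and all $\sigma\in S_n$: (i) $D(y\mid x^1,\ldots,x^k)=D(y\oplus z\mid x^1\oplus z,\ldots,x^k\oplus z)$, and (ii) $D(y\mid x^1,\ldots,x^k)=D(\sigma(y)\mid\sigma(x^1),\ldots,\sigma(x^k))$. Unbiased $k$-ary black-box algorithms. Let $\mathcal{F}$ be a class of functions $f:\{0,1\}^n\to\mathbb{R}$ to be maximized; $\mathcal F$ is known to the algorithm, but the particular $f\in\mathcal F$ is not. An unbiased $k$-ary black-box algorithm proceeds as follows: it samples $x^0$ uniformly at random from $\{0,1\}^n$ and queries $f(x^0)$; then for $t=1,2,3,\ldots$, depending only on $(f(x^0),\ldots,f(x^{t-1}))$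 (and possibly its own internal randomness), it chooses an unbiased $k$-ary variation operator $p^t$ and $k$ previously queried search points $y^1,\ldots,y^k$ (any of $x^0,\ldots,x^{t-1}$, not necessarily distinct, specified by their indices), samples $x^t$ according to $p^t(y^1,\ldots,y^k)$, and queries $f(x^t)$. Complexity. For an algorithm $A$ and $f\in\mathcal{F}$, $T_{A,f}$ is the expected number of queries until a maximizer of $f$ is queried for the first time. The unbiased $k$-ary black-box complexity of $\mathcal{F}$ is $\min_A\max_{f\in\mathcal{F}}T_{A,f}$, where $A$ ranges over all unbiased $k$-ary black-box algorithms. LeadingOnes. For $z\in\{0,1\}^n$ and $\sigma\in S_n$ let $\textsc{Lo}_{z,\sigma}:\{0,1\}^n\to[0..n]$, $\textsc{Lo}_{z,\sigma}(x):=\max\{i\in[0..n]\mid \forall j\in[i]:\ z_{\sigma(j)}=x_{\sigma(j)}\}$, where $[0]=\emptyset$. Set $\textsc{LeadingOnes}_n:=\{\textsc{Lo}_{z,\sigma}\mid z\in\{0,1\}^n,\ \sigma\in S_n\}$. *)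

theory Defs
  imports "HOL-Probability.Probability" "HOL-Combinatorics.Permutations"
begin

text \<open>
  Bit strings of length \<open>n\<close> are Boolean lists. Positions, and hence the permuted index set,
  are \<open>{..<n}\<close> instead of \<open>{1..n}\<close>.
\<close>

definition cube :: "nat \<Rightarrow> bool list set" where
  "cube n = {x. length x = n}"

definition bxor :: "bool list \<Rightarrow> bool list \<Rightarrow> bool list" where
  "bxor x z = map2 (\<noteq>) x z"

text \<open>
  A \<open>k\<close>-ary operator maps the list of its \<open>k\<close> arguments to a distribution over bit strings;
  its values on lists that are not \<open>k\<close>-tuples over the cube are irrelevant.
\<close>

type_synonym variation = "bool list list \<Rightarrow> bool list pmf"

definition unbiased_variation :: "nat \<Rightarrow> nat \<Rightarrow> variation \<Rightarrow> bool" where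
  "unbiased_variation n k D \<longleftrightarrow>
     (\<forall>xs. length xs = k \<and> set xs \<subseteq> cube n \<longrightarrow>
        set_pmf (D xs) \<subseteq> cube n \<and>
        (\<forall>y \<in> cube n. \<forall>z \<in> cube n.
           pmf (D xs) y = pmf (D (map (\<lambda>x. bxor x z) xs)) (bxor y z)) \<and>
        (\<forall>y \<in> cube n. \<forall>\<sigma>. \<sigma> permutes {..<n} \<longrightarrow>
           pmf (D xs) y = pmf (D (map (permute_list \<sigma>) xs)) (permute_list \<sigma> y)))"

text \<open>
  The decision rule of an algorithm. In \<open>A rs fs\<close>, \<open>fs\<close> is the list of all objective values
  observed so far and \<open>rs\<close> is the list of the algorithm's own earlier random outcomes. The rule
  draws a fresh outcome \<open>r\<close> (remembered for later rounds), an operator, and the indices of the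
  search points that the operator is applied to. The three may be drawn jointly, so \<open>r\<close> can record
  the operator and the indices that were drawn.
\<close>

type_synonym algorithm = "nat list \<Rightarrow> real list \<Rightarrow> (nat \<times> variation \<times> nat list) pmf"

definition unbiased_algorithm :: "nat \<Rightarrow> nat \<Rightarrow> algorithm \<Rightarrow> bool" where
  "unbiased_algorithm n k A \<longleftrightarrow>
     (\<forall>rs fs. fs \<noteq> [] \<longrightarrow>
        (\<forall>(r, D, js) \<in> set_pmf (A rs fs).
           unbiased_variation n k D \<and> length js = k \<and> set js \<subseteq> {..<length fs}))"

text \<open>
  Law of round \<open>t\<close> given a history \<open>h\<close>, of which only \<open>h 0, \<dots>, h (t - 1)\<close> are used:
  \<open>snd (h i)\<close> is the \<open>i\<close>-th search point and, for \<open>i \<ge> 1\<close>, \<open>fst (h i)\<close> is the random outcome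
  drawn in round \<open>i\<close>. No outcome is drawn in round 0, where the first component is a dummy.
\<close>

definition round_law ::
    "nat \<Rightarrow> algorithm \<Rightarrow> (bool list \<Rightarrow> real) \<Rightarrow> nat \<Rightarrow> (nat \<Rightarrow> nat \<times> bool list) \<Rightarrow> (nat \<times> bool list) pmf" where
  "round_law n A f t h =
     (if t = 0 then map_pmf (\<lambda>x. (0, x)) (pmf_of_set (cube n))
      else do {
        (r, D, js) \<leftarrow> A (map (\<lambda>i. fst (h i)) [1..<t]) (map (\<lambda>i. f (snd (h i))) [0..<t]);
        x \<leftarrow> D (map (\<lambda>j. snd (h j)) js);
        return_pmf (r, x)
      })"

text \<open>
  The random infinite trajectory. The infinite process is used to define the expected hitting time;
  it does not stop when a maximizer is found.
\<close>

lemma Ionescu_Tulcea_round_law: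
  "Ionescu_Tulcea (\<lambda>t h. measure_pmf (round_law n A f t h)) (\<lambda>_. count_space UNIV)"
proof
  fix t :: nat
  have "PiM {0..<t} (\<lambda>_. count_space (UNIV :: (nat \<times> bool list) set)) =
      count_space (PiE {0..<t} (\<lambda>_. UNIV))"
    by (rule count_space_PiM_finite) auto
  then show "(\<lambda>h. measure_pmf (round_law n A f t h)) \<in>
      PiM {0..<t} (\<lambda>_. count_space UNIV) \<rightarrow>\<^sub>M subprob_algebra (count_space UNIV)"
    by (simp add: measure_pmf_in_subprob_algebra)
qed

global_interpretation run: Ionescu_Tulcea
    "\<lambda>t h. measure_pmf (round_law n A f t h)" "\<lambda>_. count_space UNIV"
  for n :: nat and A :: algorithm and f :: "bool list \<Rightarrow> real"
  defines trajectory = run.PF.lim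
  by (rule Ionescu_Tulcea_round_law)

definition maximizer :: "nat \<Rightarrow> (bool list \<Rightarrow> real) \<Rightarrow> bool list \<Rightarrow> bool" where
  "maximizer n f x \<longleftrightarrow> is_arg_max f (\<lambda>y. y \<in> cube n) x"

text \<open>Number of queries up to and including the first query of a maximizer.\<close>

definition query_count :: "nat \<Rightarrow> (bool list \<Rightarrow> real) \<Rightarrow> (nat \<Rightarrow> nat \<times> bool list) \<Rightarrow> ennreal" where
  "query_count n f h =
     (if \<exists>t. maximizer n f (snd (h t))
      then of_nat (Suc (LEAST t. maximizer n f (snd (h t)))) else \<infinity>)"

definition expected_queries :: "nat \<Rightarrow> algorithm \<Rightarrow> (bool list \<Rightarrow> real) \<Rightarrow> ennreal" where
  "expected_queries n A f = (\<integral>\<^sup>+ h. query_count n f h \<partial>trajectory n A f)"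

definition unbiased_complexity :: "nat \<Rightarrow> nat \<Rightarrow> (bool list \<Rightarrow> real) set \<Rightarrow> ennreal" where
  "unbiased_complexity n k F =
     (INF A \<in> {A. unbiased_algorithm n k A}. SUP f \<in> F. expected_queries n A f)"

definition lo :: "nat \<Rightarrow> bool list \<Rightarrow> (nat \<Rightarrow> nat) \<Rightarrow> bool list \<Rightarrow> nat" where
  "lo n z \<sigma> x = Max {i \<in> {0..n}. \<forall>j<i. z ! \<sigma> j = x ! \<sigma> j}"

definition LeadingOnes :: "nat \<Rightarrow> (bool list \<Rightarrow> real) set" where
  "LeadingOnes n = {\<lambda>x. real (lo n z \<sigma> x) | z \<sigma>. z \<in> cube n \<and> \<sigma> permutes {..<n}}"

end

theory Submission
  imports Defs "HOL-Library.Log_Nat"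
begin

text \<open>
  Keep two search points \<open>u\<close> and \<open>w\<close> that agree, correctly, on the first \<open>n - m\<close> bits in the order
  \<open>\<sigma>\<close> and are complementary on the other \<open>m\<close> bits; a random point and its complement do for \<open>m = n\<close>.
  Exactly one of them, say \<open>u\<close>, has the critical bit \<open>\<sigma> (n - m)\<close> right. Starting from \<open>v = u\<close>, flip a
  random half of the \<open>d\<close> bits in which \<open>v\<close> and \<open>w\<close> differ. With probability at least \<open>1/2\<close> the
  critical bit is not flipped; this shows in the objective value, and the result then replaces \<open>v\<close>,
  which halves \<open>d\<close>. Once \<open>d = 1\<close>, the point \<open>v\<close> is \<open>w\<close> with just the critical bit corrected, so \<open>u\<close>
  and \<open>v\<close> are a pair as before for \<open>m - 1\<close>. The values \<open>m\<close> and \<open>d\<close> are determined by the observed objective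
  values. A phase thus takes \<open>O(log n)\<close> expected queries, which additive drift of the potential
  \<open>(m - 1) * 2 \<lceil>log n\<rceil> + 2 \<lceil>log d\<rceil>\<close> turns into the bound \<open>O(n log n)\<close>.
\<close>

section \<open>Additive drift and the expected number of queries\<close>

text \<open>A telescoping argument: integrating the drift condition over the law of the first
  \<open>t\<close> rounds bounds the probability of \<open>N t\<close> by the decrease of the
  expected \<open>V\<close>, whose total decrease cannot exceed its initial value. In the
  application, \<open>N t\<close> says that the search is still running before round
  \<open>t\<close>.\<close>

lemma (in Ionescu_Tulcea) additive_drift:
  fixes V :: "nat \<Rightarrow> (nat \<Rightarrow> 'a) \<Rightarrow> ennreal"
  assumes V[measurable]: "\<And>t. V t \<in> borel_measurable (PiM {0..<t} M)"
    and N[measurable]: "\<And>t. N t \<in> sets (PiM {0..<t} M)"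
    and drift: "\<And>t h. h \<in> space (PiM {0..<t} M) \<Longrightarrow>
      (\<integral>\<^sup>+y. V (Suc t) (fun_upd h t y) \<partial>P t h) + indicator (N t) h \<le> V t h"
  shows "(\<Sum>t. emeasure PF.lim (PF.emb UNIV {0..<t} (N t))) \<le> V 0 (\<lambda>_. undefined)"
proof -
  let ?C = "\<lambda>t. C 0 t (\<lambda>_. undefined)"
  have sp: "(\<lambda>_. undefined) \<in> space (PiM {0..<0::nat} M)"
    by (simp add: space_PiM)
  note measurable_cong_sets[OF sets_C[OF sp] refl, simp]
  have emb: "emeasure PF.lim (PF.emb UNIV {0..<t} (N t)) = emeasure (?C t) (N t)" for t
  proof -
    have "PF.emb {0..<t} {0..<t} (N t) = N t"
      using sets.sets_into_space[OF N] by (auto simp: space_PiM intro!: prod_emb_id)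
    then show ?thesis
      using emeasure_CI[of "{0..<t}" t "N t"] by (simp add: lim)
  qed
  have step: "(\<integral>\<^sup>+h. V (Suc t) h \<partial>?C (Suc t)) + emeasure (?C t) (N t) \<le> (\<integral>\<^sup>+h. V t h \<partial>?C t)" for t
  proof -
    have eP: "eP t \<in> measurable (?C t) (subprob_algebra (PiM {0..<Suc t} M))"
      using measurable_eP[of t] by simp
    have "(\<integral>\<^sup>+h. V (Suc t) h \<partial>?C (Suc t)) = (\<integral>\<^sup>+h. (\<integral>\<^sup>+h'. V (Suc t) h' \<partial>eP t h) \<partial>?C t)"
      using eP by (simp add: nn_integral_bind[OF V])
    also have "\<dots> + emeasure (?C t) (N t) =
        (\<integral>\<^sup>+h. (\<integral>\<^sup>+h'. V (Suc t) h' \<partial>eP t h) + indicator (N t) h \<partial>?C t)"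
    proof (subst nn_integral_add)
      show "(\<lambda>h. \<integral>\<^sup>+h'. V (Suc t) h' \<partial>eP t h) \<in> borel_measurable (?C t)"
        by simp
    qed (auto simp: sets_C[OF sp])
    also have "\<dots> \<le> (\<integral>\<^sup>+h. V t h \<partial>?C t)"
      by (intro nn_integral_mono) (simp add: space_C[OF sp] nn_integral_eP drift)
    finally show ?thesis .
  qed
  \<comment> \<open>The expected remaining potential is carried along in the induction and dropped
    afterwards.\<close>
  have "(\<Sum>t<T. emeasure (?C t) (N t)) + (\<integral>\<^sup>+h. V T h \<partial>?C T) \<le> V 0 (\<lambda>_. undefined)" for T
  proof (induction T)
    case 0
    show ?case
      using nn_integral_return[OF sp V] by simp
  next
    case (Suc T)
    have "(\<Sum>t<Suc T. emeasure (?C t) (N t)) + (\<integral>\<^sup>+h. V (Suc T) h \<partial>?C (Suc T)) =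
        (\<Sum>t<T. emeasure (?C t) (N t)) + ((\<integral>\<^sup>+h. V (Suc T) h \<partial>?C (Suc T)) + emeasure (?C T) (N T))"
      by (simp add: ac_simps del: C.simps)
    also have "\<dots> \<le> (\<Sum>t<T. emeasure (?C t) (N t)) + (\<integral>\<^sup>+h. V T h \<partial>?C T)"
      by (intro add_left_mono step)
    also have "\<dots> \<le> V 0 (\<lambda>_. undefined)"
      by (rule Suc)
    finally show ?case .
  qed
  then have "(\<Sum>t<T. emeasure (?C t) (N t)) \<le> V 0 (\<lambda>_. undefined)" for T
    by (meson add_increasing2 order_trans zero_le le_iff_add)
  then show ?thesis
    unfolding emb by (intro suminf_le_const) auto
qed

text \<open>Only rounds before \<open>t\<close> count, so the event depends on \<open>h 0\<close>,
  ..., \<open>h (t - 1)\<close> and says exactly that query \<open>t\<close> still has to be paid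
  for.\<close>

definition unsolved :: "nat \<Rightarrow> (bool list \<Rightarrow> real) \<Rightarrow> nat \<Rightarrow> (nat \<Rightarrow> nat \<times> bool list) \<Rightarrow> bool" where
  "unsolved n f t h \<longleftrightarrow> (\<forall>i<t. \<not> maximizer n f (snd (h i)))"

text \<open>If \<open>L\<close> is the first round that hits a maximizer, precisely the
  \<open>L + 1\<close> terms with \<open>t \<le> L\<close> are 1; without a hit all terms are 1 and
  the sum diverges.\<close>

lemma query_count_eq_suminf:
  "query_count n f h = (\<Sum>t. indicator {h. unsolved n f t h} h)"
proof (cases "\<exists>t. maximizer n f (snd (h t))")
  case True
  define L where "L = (LEAST t. maximizer n f (snd (h t)))"
  have max_L: "maximizer n f (snd (h L))"
    unfolding L_def using True by (rule LeastI_ex)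
  have min_L: "\<not> maximizer n f (snd (h i))" if "i < L" for i
    using that unfolding L_def by (rule not_less_Least)
  have "unsolved n f t h \<longleftrightarrow> t \<in> {..<Suc L}" for t
    unfolding unsolved_def using max_L min_L by (auto simp: less_Suc_eq_le not_less[symmetric])
  then have "(\<Sum>t. indicator {h. unsolved n f t h} h) = (\<Sum>t<Suc L. 1 :: ennreal)"
    by (subst suminf_finite[of "{..<Suc L}"]) (auto simp: indicator_def)
  then show ?thesis
    using True by (simp add: query_count_def L_def)
next
  case False
  then have "(\<lambda>t. indicator {h. unsolved n f t h} h) = (\<lambda>_. 1 :: ennreal)"
    by (auto simp: unsolved_def fun_eq_iff)
  moreover have "(\<Sum>t::nat. 1 :: ennreal) = \<infinity>"
    by (simp add: suminf_eq_SUP ennreal_SUP_of_nat_eq_top)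
  ultimately show ?thesis
    using False by (simp add: query_count_def)
qed

text \<open>The expectation of the tail sum is a sum of probabilities of cylinder events, to which
  additive drift applies. Finite histories form a countable discrete space, so measurability of
  \<open>V\<close> is automatic.\<close>

lemma expected_queries_le:
  fixes V :: "nat \<Rightarrow> (nat \<Rightarrow> nat \<times> bool list) \<Rightarrow> ennreal"
  assumes drift: "\<And>t h. (\<integral>\<^sup>+y. V (Suc t) (h(t := y)) \<partial>measure_pmf (round_law n A f t h)) +
      indicator {h. unsolved n f t h} h \<le> V t h"
  shows "expected_queries n A f \<le> V 0 (\<lambda>_. undefined)"
proof -
  let ?M = "\<lambda>_::nat. count_space (UNIV :: (nat \<times> bool list) set)"
  have PiM: "PiM {0..<t} ?M = count_space (PiE {0..<t} (\<lambda>_. UNIV))" for t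
    by (rule count_space_PiM_finite) auto
  define N where "N t = {h \<in> space (PiM {0..<t} ?M). unsolved n f t h}" for t
  have emb: "prod_emb UNIV ?M {0..<t} (N t) = {h. unsolved n f t h}" for t
    by (auto simp: prod_emb_def N_def space_PiM unsolved_def)
  have meas: "{h. unsolved n f t h} \<in> sets (trajectory n A f)" for t
  proof -
    have "prod_emb UNIV ?M {0..<t} (N t) \<in> sets (PiM UNIV ?M)"
      by (intro measurable_prod_emb) (auto simp: N_def PiM)
    then show ?thesis by (simp add: emb)
  qed
  have "expected_queries n A f = (\<integral>\<^sup>+h. (\<Sum>t. indicator {h. unsolved n f t h} h) \<partial>trajectory n A f)"
    by (simp add: expected_queries_def query_count_eq_suminf)
  also have "\<dots> = (\<Sum>t. emeasure (trajectory n A f) {h. unsolved n f t h})"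
    using meas by (subst nn_integral_suminf) (simp_all only: nn_integral_indicator borel_measurable_indicator)
  also have "\<dots> = (\<Sum>t. emeasure (trajectory n A f) (prod_emb UNIV ?M {0..<t} (N t)))"
    by (simp add: emb)
  also have "\<dots> \<le> V 0 (\<lambda>_. undefined)"
  proof (rule run.additive_drift)
    show "V t \<in> borel_measurable (PiM {0..<t} ?M)" for t
      by (simp add: PiM)
    show "N t \<in> sets (PiM {0..<t} ?M)" for t
      by (simp add: PiM N_def)
    show "(\<integral>\<^sup>+y. V (Suc t) (h(t := y)) \<partial>measure_pmf (round_law n A f t h)) + indicator (N t) h \<le> V t h"
      if "h \<in> space (PiM {0..<t} ?M)" for t h
      using drift[where t=t and h=h] that by (simp add: N_def indicator_def)
  qed
  finally show ?thesis .
qed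

section \<open>The halving operator and its unbiasedness\<close>

definition diff :: "nat \<Rightarrow> bool list \<Rightarrow> bool list \<Rightarrow> nat set" where
  "diff n u v = {i. i < n \<and> u ! i \<noteq> v ! i}"

definition flip :: "nat \<Rightarrow> bool list \<Rightarrow> nat set \<Rightarrow> bool list" where
  "flip n u S = map (\<lambda>i. u ! i \<noteq> (i \<in> S)) [0..<n]"

text \<open>Rounding the size down makes every differing bit survive with probability at least 1/2,
  also for an odd number of them.\<close>

definition flip_sets :: "nat \<Rightarrow> bool list \<Rightarrow> bool list \<Rightarrow> nat set set" where
  "flip_sets n u v = (if u = v then {{..<n}}
     else {S. S \<subseteq> diff n u v \<and> card S = card (diff n u v) div 2})"

text \<open>Equal arguments make \<^term>\<open>halving n\<close> return the complement, so a single operator suffices.\<close>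

definition halving :: "nat \<Rightarrow> variation" where
  "halving n xs = map_pmf (flip n (xs ! 0)) (pmf_of_set (flip_sets n (xs ! 0) (xs ! 1)))"

lemma finite_diff [simp]: "finite (diff n u v)"
  by (simp add: diff_def)

lemma flip_sets_subset: "S \<in> flip_sets n u v \<Longrightarrow> S \<subseteq> {..<n}"
  by (auto simp: flip_sets_def diff_def split: if_splits)

lemma finite_flip_sets [simp]: "finite (flip_sets n u v)"
  by (rule finite_subset[of _ "Pow {..<n}"]) (auto dest: flip_sets_subset)

lemma flip_sets_nonempty [simp]: "flip_sets n u v \<noteq> {}"
proof -
  obtain S where "S \<subseteq> diff n u v" "card S = card (diff n u v) div 2"
    using obtain_subset_with_card_n[of "card (diff n u v) div 2" "diff n u v"] by auto
  then show ?thesis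
    by (auto simp: flip_sets_def)
qed

lemma flip_in_cube: "flip n u S \<in> cube n"
  by (simp add: flip_def cube_def)

lemma bxor_bxor_cancel: "x \<in> cube n \<Longrightarrow> z \<in> cube n \<Longrightarrow> bxor (bxor x z) z = x"
  by (auto simp: cube_def bxor_def intro!: nth_equalityI)

lemma permute_list_inj_on_cube:
  assumes "\<sigma> permutes {..<n}"
  shows "inj_on (permute_list \<sigma>) (cube n)"
proof (rule inj_onI, rule nth_equalityI)
  fix x y i assume xy: "x \<in> cube n" "y \<in> cube n" "permute_list \<sigma> x = permute_list \<sigma> y"
  then show "length x = length y" by (simp add: cube_def)
  assume "i < length x"
  with xy(1) have "i \<in> \<sigma> ` {..<n}"
    by (simp add: cube_def permutes_image[OF assms])
  then obtain j where j: "j < n" "i = \<sigma> j"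
    by auto
  have "permute_list \<sigma> x ! j = permute_list \<sigma> y ! j"
    by (simp add: xy)
  then show "x ! i = y ! i"
    using xy(1,2) assms j by (simp add: cube_def permute_list_nth)
qed

text \<open>Off the support both sides vanish, because injectivity on \<open>C\<close> keeps
  \<open>g y\<close> out of the image of the support. This turns equivariance of a distribution into
  the pointwise equations of unbiasedness.\<close>

lemma pmf_map_inj_on:
  assumes "inj_on g C" "set_pmf p \<subseteq> C" "y \<in> C"
  shows "pmf (map_pmf g p) (g y) = pmf p y"
proof (cases "y \<in> set_pmf p")
  case True
  then show ?thesis
    using assms inj_on_subset pmf_map_inj by metis
next
  case False
  then have "g y \<notin> set_pmf (map_pmf g p)"
    using assms by (auto dest: inj_onD)
  with False show ?thesis
    by (simp only: set_pmf_iff not_not)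
qed

lemma halving_in_cube: "set_pmf (halving n xs) \<subseteq> cube n"
  by (auto simp: halving_def flip_in_cube)

text \<open>A common translation leaves the set of differing positions unchanged and commutes with
  flipping.\<close>

lemma halving_bxor:
  assumes "u \<in> cube n" "v \<in> cube n" "z \<in> cube n"
  shows "halving n [bxor u z, bxor v z] = map_pmf (\<lambda>x. bxor x z) (halving n [u, v])"
proof -
  have "bxor u z = bxor v z \<longleftrightarrow> u = v"
    using assms by (metis bxor_bxor_cancel)
  moreover have "diff n (bxor u z) (bxor v z) = diff n u v"
    using assms by (auto simp: diff_def bxor_def cube_def)
  moreover have "flip n (bxor u z) = (\<lambda>S. bxor (flip n u S) z)"
    using assms by (auto simp: flip_def bxor_def cube_def fun_eq_iff intro!: nth_equalityI)
  ultimately show ?thesis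
    unfolding halving_def flip_sets_def by (simp only: nth_Cons_0 nth_Cons_Suc One_nat_def map_pmf_comp)
qed

text \<open>Permuting both arguments replaces the set of differing positions by its preimage under
  \<sigma>. Taking preimages is injective and preserves cardinality, so the uniform choice of a flip
  set is carried to a uniform choice.\<close>

lemma halving_permute:
  assumes uv: "u \<in> cube n" "v \<in> cube n" and \<sigma>: "\<sigma> permutes {..<n}"
  shows "halving n [permute_list \<sigma> u, permute_list \<sigma> v] = map_pmf (permute_list \<sigma>) (halving n [u, v])"
proof -
  have len: "length u = n" "length v = n"
    using uv by (auto simp: cube_def)
  have nth: "permute_list \<sigma> x ! i = x ! \<sigma> i" if "length x = n" "i < n" for x :: "bool list" and i
    using that \<sigma> by (simp add: permute_list_nth)
  have lt: "\<sigma> i < n \<longleftrightarrow> i < n" for i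
    using permutes_in_image[OF \<sigma>] by auto
  have eq: "permute_list \<sigma> u = permute_list \<sigma> v \<longleftrightarrow> u = v"
    using permute_list_inj_on_cube[OF \<sigma>] uv by (auto dest: inj_onD)
  have diff: "diff n (permute_list \<sigma> u) (permute_list \<sigma> v) = \<sigma> -` diff n u v"
    using len by (auto simp: diff_def nth lt)
  have bij: "bij \<sigma>"
    using \<sigma> permutes_bij by blast
  have card: "card (\<sigma> -` S) = card S" for S
    using bij by (intro card_vimage_inj) (auto simp: bij_is_inj bij_is_surj)
  have im: "\<sigma> -` (\<sigma> ` S) = S" "\<sigma> ` (\<sigma> -` S) = S" for S
    using bij by (auto simp: bij_is_inj bij_is_surj inj_vimage_image_eq)
  have img: "flip_sets n (permute_list \<sigma> u) (permute_list \<sigma> v) = vimage \<sigma> ` flip_sets n u v"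
  proof (cases "u = v")
    case True
    have "\<sigma> -` {..<n} = {..<n}" by (auto simp: lt)
    with True show ?thesis by (simp add: flip_sets_def)
  next
    case False
    have "S \<in> vimage \<sigma> ` {S. S \<subseteq> diff n u v \<and> card S = card (diff n u v) div 2}"
      if "S \<subseteq> \<sigma> -` diff n u v" "card S = card (diff n u v) div 2" for S
    proof (rule image_eqI)
      show "S = \<sigma> -` (\<sigma> ` S)" by (simp add: im)
      show "\<sigma> ` S \<in> {S. S \<subseteq> diff n u v \<and> card S = card (diff n u v) div 2}"
        using that card[of "\<sigma> ` S"] by (auto simp: im)
    qed
    with False show ?thesis
      by (auto simp: flip_sets_def eq diff card)
  qed
  have inj: "inj_on (vimage \<sigma>) (flip_sets n u v)"
    by (rule inj_onI) (metis im(2))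
  have fl: "flip n (permute_list \<sigma> u) (\<sigma> -` S) = permute_list \<sigma> (flip n u S)" for S
    by (rule nth_equalityI) (auto simp: flip_def nth len lt)
  show ?thesis
    by (simp add: halving_def img map_pmf_of_set_inj[OF inj, symmetric] map_pmf_comp fl)
qed

lemma unbiased_halving: "unbiased_variation n 2 (halving n)"
  unfolding unbiased_variation_def
proof (intro allI impI conjI ballI)
  fix xs :: "bool list list" assume xs: "length xs = 2 \<and> set xs \<subseteq> cube n"
  then obtain u v where [simp]: "xs = [u, v]"
    by (metis (no_types, opaque_lifting) One_nat_def Suc_1 length_0_conv length_Suc_conv)
  from xs have uv: "u \<in> cube n" "v \<in> cube n" by auto
  show "set_pmf (halving n xs) \<subseteq> cube n"
    by (rule halving_in_cube)
  fix y assume y: "y \<in> cube n"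
  show "pmf (halving n xs) y = pmf (halving n (map (\<lambda>x. bxor x z) xs)) (bxor y z)" if z: "z \<in> cube n" for z
  proof -
    have "inj_on (\<lambda>x. bxor x z) (cube n)"
      by (rule inj_on_inverseI[where g="\<lambda>x. bxor x z"]) (rule bxor_bxor_cancel[OF _ z])
    from pmf_map_inj_on[OF this halving_in_cube y, of xs] show ?thesis
      using uv z by (simp add: halving_bxor)
  qed
  show "pmf (halving n xs) y = pmf (halving n (map (permute_list \<sigma>) xs)) (permute_list \<sigma> y)"
    if "\<sigma> permutes {..<n}" for \<sigma>
    using pmf_map_inj_on[OF permute_list_inj_on_cube[OF that] halving_in_cube y, of xs] uv that
    by (simp add: halving_permute)
qed

section \<open>Objective values and the pairs of points kept by the search\<close>

lemma le_lo_iff: "k \<le> lo n z \<sigma> x \<longleftrightarrow> k \<le> n \<and> (\<forall>j<k. z ! \<sigma> j = x ! \<sigma> j)"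
  unfolding lo_def by (subst Max_ge_iff) auto

lemma lo_le: "lo n z \<sigma> x \<le> n"
  using le_lo_iff[of "lo n z \<sigma> x" n z \<sigma> x] by simp

text \<open>Once \<open>k\<close> bits are right, a comparison of the objective value with
  \<open>k\<close> reveals exactly one further bit.\<close>

lemma less_lo_iff:
  assumes "k \<le> lo n z \<sigma> x" "k < n"
  shows "k < lo n z \<sigma> x \<longleftrightarrow> z ! \<sigma> k = x ! \<sigma> k"
  using assms by (subst Suc_le_eq[symmetric]) (auto simp: le_lo_iff less_Suc_eq)

lemma lo_less_if_not_maximizer:
  assumes "x \<in> cube n" "\<not> maximizer n (\<lambda>x. real (lo n z \<sigma> x)) x"
  shows "lo n z \<sigma> x < n"
  using assms lo_le[of n z \<sigma>] unfolding maximizer_def is_arg_max_def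
  by (meson less_le_trans not_le of_nat_less_iff)

text \<open>The pair encodes the unknown set of open positions as its set of differing bits, so an
  operator can act on this set without knowing \<sigma>.\<close>

definition complementary :: "nat \<Rightarrow> bool list \<Rightarrow> (nat \<Rightarrow> nat) \<Rightarrow> nat \<Rightarrow> bool list \<Rightarrow> bool list \<Rightarrow> bool" where
  "complementary n z \<sigma> m u v \<longleftrightarrow> u \<in> cube n \<and> v \<in> cube n \<and> m \<le> n \<and>
     diff n u v = \<sigma> ` {n - m..<n} \<and> n - m \<le> lo n z \<sigma> u \<and> n - m \<le> lo n z \<sigma> v"

lemma complementary_commute: "complementary n z \<sigma> m u v \<longleftrightarrow> complementary n z \<sigma> m v u"
proof -
  have "diff n u v = diff n v u" by (auto simp: diff_def)
  then show ?thesis by (auto simp: complementary_def)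
qed

text \<open>The two points differ in the critical bit \<open>\<sigma> (n - m)\<close>, so exactly
  one of them has it right. For \<open>m = 1\<close> that point would already have value
  \<open>n\<close>.\<close>

lemma complementary_lo:
  assumes c: "complementary n z \<sigma> m u v" and m: "1 \<le> m"
    and lo: "lo n z \<sigma> u < n" "lo n z \<sigma> v < n"
  shows "2 \<le> m" "n - m < lo n z \<sigma> u \<longleftrightarrow> lo n z \<sigma> v = n - m"
proof -
  have mn: "n - m < n" "m \<le> n"
    using c m by (auto simp: complementary_def)
  have ge: "n - m \<le> lo n z \<sigma> u" "n - m \<le> lo n z \<sigma> v"
    using c by (auto simp: complementary_def)
  have "\<sigma> (n - m) \<in> diff n u v"
    using c mn by (simp add: complementary_def)
  then have "u ! \<sigma> (n - m) \<noteq> v ! \<sigma> (n - m)"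
    by (simp add: diff_def)
  then have iff: "n - m < lo n z \<sigma> u \<longleftrightarrow> \<not> n - m < lo n z \<sigma> v"
    using less_lo_iff[OF ge(1) mn(1)] less_lo_iff[OF ge(2) mn(1)] by auto
  then show "n - m < lo n z \<sigma> u \<longleftrightarrow> lo n z \<sigma> v = n - m"
    using ge by auto
  show "2 \<le> m"
    using iff lo mn m by (cases "m = 1") auto
qed

text \<open>The inclusion says that \<open>v\<close> arises from \<open>u\<close> by flipping open
  bits only. The \<open>d\<close> bits in which \<open>v\<close> and \<open>w\<close> differ are the
  remaining candidates for the critical bit; a single candidate ends the phase, hence
  \<open>2 \<le> d\<close>.\<close>

definition searching ::
    "nat \<Rightarrow> bool list \<Rightarrow> (nat \<Rightarrow> nat) \<Rightarrow> bool list \<Rightarrow> bool list \<Rightarrow> bool list \<Rightarrow> nat \<Rightarrow> nat \<Rightarrow> bool" where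
  "searching n z \<sigma> u v w m d \<longleftrightarrow> complementary n z \<sigma> m u w \<and> 2 \<le> m \<and> lo n z \<sigma> w = n - m \<and>
     n - m < lo n z \<sigma> u \<and> v \<in> cube n \<and> n - m < lo n z \<sigma> v \<and>
     diff n v w \<subseteq> diff n u w \<and> card (diff n v w) = d \<and> 2 \<le> d"

lemma searching_critical:
  assumes "searching n z \<sigma> u v w m d" "\<sigma> permutes {..<n}"
  shows "\<sigma> (n - m) \<in> diff n v w"
proof -
  have mn: "n - m < n"
    using assms by (auto simp: searching_def complementary_def)
  then have "z ! \<sigma> (n - m) = v ! \<sigma> (n - m)" "z ! \<sigma> (n - m) \<noteq> w ! \<sigma> (n - m)"
    using less_lo_iff[of "n - m" n z \<sigma> v] less_lo_iff[of "n - m" n z \<sigma> w] assms(1)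
    by (auto simp: searching_def)
  moreover have "\<sigma> (n - m) < n"
    using permutes_in_image[OF assms(2), of "n - m"] mn by simp
  ultimately show ?thesis
    by (auto simp: diff_def)
qed

lemma flip_nth: "i < n \<Longrightarrow> flip n u S ! i \<longleftrightarrow> (u ! i \<noteq> (i \<in> S))"
  by (simp add: flip_def)

text \<open>All flipped positions are open, so the first \<open>n - m\<close> bits stay right, and
  the critical bit, right in \<open>v\<close>, is lost only if it is flipped. The objective value
  therefore serves as acceptance test.\<close>

lemma lo_flip:
  assumes s: "searching n z \<sigma> u v w m d" and \<sigma>: "\<sigma> permutes {..<n}" and S: "S \<subseteq> diff n v w"
  shows "n - m < lo n z \<sigma> (flip n v S) \<longleftrightarrow> \<sigma> (n - m) \<notin> S"
proof -
  have mn: "n - m < n"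
    using s by (auto simp: searching_def complementary_def)
  have lt: "\<sigma> j < n" if "j < n" for j
    using permutes_in_image[OF \<sigma>, of j] that by simp
  have eq: "\<sigma> i = \<sigma> j \<longleftrightarrow> i = j" for i j
    using permutes_inj[OF \<sigma>] by (simp add: inj_eq)
  have out: "\<sigma> j \<notin> S" if "j < n - m" for j
    using S s that by (force simp: searching_def complementary_def eq)
  have agree: "z ! \<sigma> j = v ! \<sigma> j" if "j \<le> n - m" for j
  proof -
    have "Suc (n - m) \<le> lo n z \<sigma> v"
      using s by (simp add: searching_def)
    with that show ?thesis by (simp add: le_lo_iff)
  qed
  have "n - m \<le> lo n z \<sigma> (flip n v S)"
    unfolding le_lo_iff using agree out lt by (auto simp: flip_nth)
  from less_lo_iff[OF this mn] show ?thesis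
    using agree[of "n - m"] lt[OF mn] by (auto simp: flip_nth)
qed

lemma diff_flip: "S \<subseteq> diff n v w \<Longrightarrow> diff n (flip n v S) w = diff n v w - S"
  by (auto simp: diff_def flip_nth)

text \<open>Bits are Boolean: among the positions where \<open>u\<close> and \<open>w\<close>
  differ, \<open>v\<close> agrees with exactly one of the two.\<close>

lemma diff_minus_diff: "diff n v w \<subseteq> diff n u w \<Longrightarrow> diff n u v = diff n u w - diff n v w"
  by (auto simp: diff_def)

section \<open>The algorithm\<close>

type_synonym search_state = "nat \<times> nat \<times> nat \<times> nat \<times> nat"

text \<open>
  A state \<open>(a, b, c, m, d)\<close> holds the indices of the points \<open>u\<close>, \<open>v\<close>, \<open>w\<close> and the numbers \<open>m\<close> and \<open>d\<close>.
\<close>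

definition new_phase :: "nat \<Rightarrow> nat \<Rightarrow> nat \<Rightarrow> real \<Rightarrow> nat \<Rightarrow> search_state" where
  "new_phase n a t y m = (if y > real n - real m then (t, t, a, m, m) else (a, a, t, m, m))"

text \<open>The test asks whether the critical bit survived. It subtracts in the reals, so that for
  \<open>m = n + 1\<close> the threshold is -1 and every value passes.\<close>

fun update :: "nat \<Rightarrow> nat \<Rightarrow> real \<Rightarrow> search_state \<Rightarrow> search_state" where
  "update n t y (a, b, c, m, d) =
     (if y > real n - real m then
        if d - d div 2 = 1 then new_phase n a t y (m - 1) else (a, t, c, m, d - d div 2)
      else (a, b, c, m, d))"

text \<open>
  The initial state mimics the end of a phase for \<open>m = n + 1\<close>: the complement of the first point is
  accepted whatever its value, and opens the phase for \<open>m = n\<close>.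
\<close>

primrec state :: "nat \<Rightarrow> (nat \<Rightarrow> real) \<Rightarrow> nat \<Rightarrow> search_state" where
  "state n g 0 = (0, 0, 0, n + 1, 1)"
| "state n g (Suc t) = update n (Suc t) (g (Suc t)) (state n g t)"

text \<open>The whole state is recomputed from the observed values, the last of which has index
  \<open>length fs - 1\<close>. The decision rule is deterministic, so the recorded outcome is a
  dummy 0.\<close>

definition searcher :: "nat \<Rightarrow> algorithm" where
  "searcher n rs fs = (case state n ((!) fs) (length fs - 1) of
     (a, b, c, m, d) \<Rightarrow> return_pmf (0, halving n, [b, c]))"

lemma state_cong: "(\<And>i. i \<le> t \<Longrightarrow> g i = g' i) \<Longrightarrow> state n g t = state n g' t"
  by (induction t) auto

lemma state_le: "state n g t = (a, b, c, m, d) \<Longrightarrow> a \<le> t \<and> b \<le> t \<and> c \<le> t"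
proof (induction t arbitrary: a b c m d)
  case (Suc t)
  obtain a' b' c' m' d' where s: "state n g t = (a', b', c', m', d')"
    by (cases "state n g t")
  from Suc.IH[OF s] Suc.prems s show ?case
    by (auto simp: new_phase_def split: if_splits)
qed simp

lemma unbiased_searcher: "unbiased_algorithm n 2 (searcher n)"
  unfolding unbiased_algorithm_def
proof (intro allI impI)
  fix rs :: "nat list" and fs :: "real list" assume "fs \<noteq> []"
  obtain a b c m d where s: "state n ((!) fs) (length fs - 1) = (a, b, c, m, d)"
    by (cases "state n ((!) fs) (length fs - 1)")
  from state_le[OF s] \<open>fs \<noteq> []\<close> have "b < length fs" "c < length fs"
    by (cases fs; simp)+
  then show "\<forall>(r, D, js)\<in>set_pmf (searcher n rs fs).
      unbiased_variation n 2 D \<and> length js = 2 \<and> set js \<subseteq> {..<length fs}"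
    unfolding searcher_def s by (simp add: unbiased_halving)
qed

text \<open>Given the history, the choice of the flip set is the only randomness in a round.\<close>

lemma round_law_searcher:
  assumes "state n (\<lambda>i. f (snd (h i))) t = (a, b, c, m, d)"
  shows "round_law n (searcher n) f (Suc t) h =
    map_pmf (\<lambda>S. (0, flip n (snd (h b)) S)) (pmf_of_set (flip_sets n (snd (h b)) (snd (h c))))"
proof -
  let ?fs = "map (\<lambda>i. f (snd (h i))) [0..<Suc t]"
  have "state n ((!) ?fs) t = state n (\<lambda>i. f (snd (h i))) t"
    by (rule state_cong) (simp del: upt_Suc)
  then have "searcher n rs ?fs = return_pmf (0, halving n, [b, c])" for rs
    using assms by (simp add: searcher_def del: upt_Suc)
  then show ?thesis
    by (simp add: round_law_def halving_def bind_return_pmf map_pmf_def bind_assoc_pmf del: upt_Suc)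
qed

section \<open>Invariant and cost of a state\<close>

fun progress :: "nat \<Rightarrow> bool list \<Rightarrow> (nat \<Rightarrow> nat) \<Rightarrow> (nat \<Rightarrow> bool list) \<Rightarrow> search_state \<Rightarrow> bool" where
  "progress n z \<sigma> p (a, b, c, m, d) \<longleftrightarrow> searching n z \<sigma> (p a) (p b) (p c) m d"

text \<open>Two rounds are budgeted per successful halving: \<open>ceillog2 d\<close> halvings
  finish the current phase, and each of at most \<open>m - 1\<close> later phases needs at most
  \<open>ceillog2 n\<close>.\<close>

fun cost :: "nat \<Rightarrow> search_state \<Rightarrow> nat" where
  "cost n (a, b, c, m, d) = (m - 1) * (2 * ceillog2 n) + 2 * ceillog2 d"

text \<open>Exactly one point of the pair has the critical bit right, so the value of the newer one
  settles both roles. The new phase starts with \<open>d = m \<le> n\<close>, which gives the cost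
  bound.\<close>

lemma progress_new_phase:
  assumes c: "complementary n z \<sigma> m (p a) (p t)" and m: "1 \<le> m" and \<sigma>: "\<sigma> permutes {..<n}"
    and lo: "lo n z \<sigma> (p a) < n" "lo n z \<sigma> (p t) < n"
  shows "progress n z \<sigma> p (new_phase n a t (real (lo n z \<sigma> (p t))) m)"
    and "cost n (new_phase n a t (real (lo n z \<sigma> (p t))) m) \<le> m * (2 * ceillog2 n)"
proof -
  have c': "complementary n z \<sigma> m (p t) (p a)"
    using c complementary_commute by blast
  have mn: "m \<le> n" "p a \<in> cube n" "p t \<in> cube n"
    using c by (auto simp: complementary_def)
  have card: "card (\<sigma> ` {n - m..<n}) = m"
    using permutes_inj[OF \<sigma>] mn by (subst card_image) (auto intro: inj_on_subset)
  note lo_iff = complementary_lo[OF c m lo] complementary_lo[OF c' m lo(2,1)]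
  \<comment> \<open>As \<open>m \<le> n\<close>, the real threshold agrees with the truncated
    natural one.\<close>
  have *: "real (lo n z \<sigma> (p t)) > real n - real m \<longleftrightarrow> lo n z \<sigma> (p t) > n - m"
    using mn by linarith
  have ge: "n - m \<le> lo n z \<sigma> (p t)"
    using c by (simp add: complementary_def)
  show "progress n z \<sigma> p (new_phase n a t (real (lo n z \<sigma> (p t))) m)"
    using lo_iff card c c' mn ge
    by (auto simp: new_phase_def searching_def * complementary_def)
  have "ceillog2 m \<le> ceillog2 n"
    using mn m by (intro ceillog2_mono) auto
  then have "(m - 1) * (2 * ceillog2 n) + 2 * ceillog2 m \<le> (m - 1) * (2 * ceillog2 n) + 2 * ceillog2 n"
    by simp
  also have "\<dots> = m * (2 * ceillog2 n)"
    using m by (cases m) (auto simp: algebra_simps)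
  finally show "cost n (new_phase n a t (real (lo n z \<sigma> (p t))) m) \<le> m * (2 * ceillog2 n)"
    by (simp add: new_phase_def)
qed

lemma ceillog2_halve: "2 \<le> d \<Longrightarrow> ceillog2 d = Suc (ceillog2 (d - d div 2))"
proof -
  assume "2 \<le> d"
  moreover have "(d + 1) div 2 = d - d div 2" by presburger
  ultimately show ?thesis by (simp add: ceillog2_rec[of d])
qed

text \<open>Sparing the critical bit leaves \<open>d - d div 2\<close> candidates, including the
  critical one. Either the phase goes on with one halving fewer to do, or the only candidate left is
  the critical bit and the next phase opens.\<close>

lemma progress_update:
  assumes s: "searching n z \<sigma> (p a) (p b) (p c) m d" and \<sigma>: "\<sigma> permutes {..<n}"
    and S: "S \<subseteq> diff n (p b) (p c)" "card S = d div 2" and p: "p t = flip n (p b) S"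
    and crit: "\<sigma> (n - m) \<notin> S"
    and lo: "lo n z \<sigma> (p a) < n" "lo n z \<sigma> (p t) < n"
  shows "progress n z \<sigma> p (update n t (real (lo n z \<sigma> (p t))) (a, b, c, m, d))"
    and "cost n (update n t (real (lo n z \<sigma> (p t))) (a, b, c, m, d)) + 2 \<le> cost n (a, b, c, m, d)"
proof -
  let ?s' = "update n t (real (lo n z \<sigma> (p t))) (a, b, c, m, d)"
  have m: "2 \<le> m" "m \<le> n" and d: "2 \<le> d" "card (diff n (p b) (p c)) = d"
    and sub: "diff n (p b) (p c) \<subseteq> diff n (p a) (p c)"
    using s by (auto simp: searching_def complementary_def)
  have better: "n - m < lo n z \<sigma> (p t)"
    using lo_flip[OF s \<sigma> S(1)] crit p by simp
  have t: "p t \<in> cube n"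
    by (simp add: p flip_in_cube)
  have diff: "diff n (p t) (p c) = diff n (p b) (p c) - S"
    by (simp add: p diff_flip S)
  have card: "card (diff n (p t) (p c)) = d - d div 2"
    using S d finite_subset[OF S(1)] by (simp add: diff card_Diff_subset)
  have log: "ceillog2 d = Suc (ceillog2 (d - d div 2))"
    by (rule ceillog2_halve) (rule d)
  have "progress n z \<sigma> p ?s' \<and> cost n ?s' + 2 \<le> cost n (a, b, c, m, d)"
  proof (cases "d - d div 2 = 1")
    case True
    then have upd: "?s' = new_phase n a t (real (lo n z \<sigma> (p t))) (m - 1)"
      using better m by auto
    have "\<sigma> (n - m) \<in> diff n (p t) (p c)"
      using searching_critical[OF s \<sigma>] crit by (simp add: diff)
    then have single: "diff n (p t) (p c) = {\<sigma> (n - m)}"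
      using card True by (metis card_1_singletonE singletonD)
    have "diff n (p a) (p t) = diff n (p a) (p c) - {\<sigma> (n - m)}"
      using diff_minus_diff[of n "p t" "p c" "p a"] sub diff by (auto simp: single)
    also have "\<dots> = \<sigma> ` ({n - m..<n} - {n - m})"
      using s permutes_inj[OF \<sigma>] by (simp add: searching_def complementary_def image_set_diff)
    also have "{n - m..<n} - {n - m} = {n - (m - 1)..<n}"
      using m by auto
    \<comment> \<open>The new point is \<open>w\<close> with only the critical bit corrected, so it
      differs from \<open>u\<close> in the other open bits.\<close>
    finally have "complementary n z \<sigma> (m - 1) (p a) (p t)"
      using s t better m by (auto simp: complementary_def searching_def)
    \<comment> \<open>Here \<open>ceillog2 d = 1\<close>, so the last halving of the phase releases
      exactly the required 2.\<close>
    from progress_new_phase[OF this _ \<sigma> lo] m log True show ?thesis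
      unfolding upd by simp
  next
    case False
    then have upd: "?s' = (a, t, c, m, d - d div 2)"
      using better m by auto
    have "2 \<le> d - d div 2"
      using d False by presburger
    then have "progress n z \<sigma> p (a, t, c, m, d - d div 2)"
      using s t better card diff by (auto simp: searching_def)
    then show ?thesis
      unfolding upd by (simp add: log)
  qed
  then show "progress n z \<sigma> p ?s'" "cost n ?s' + 2 \<le> cost n (a, b, c, m, d)"
    by auto
qed

section \<open>Drift of the potential\<close>

text \<open>With \<open>k = d div 2\<close>, absorption gives
  \<open>(d - k) * (d choose k) = d * ((d - 1) choose k)\<close>, and
  \<open>2 * (d - k) \<ge> d\<close>.\<close>

lemma card_half_subsets_le:
  fixes D :: "'a set"
  assumes D: "finite D" and c: "c \<in> D"
  defines "F \<equiv> {S. S \<subseteq> D \<and> card S = card D div 2}"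
  shows "card F \<le> 2 * card {S \<in> F. c \<notin> S}"
proof -
  let ?d = "card D" and ?k = "card D div 2"
  have d: "?d > 0"
    using assms card_gt_0_iff by blast
  have "{S \<in> F. c \<notin> S} = {S. S \<subseteq> D - {c} \<and> card S = ?k}"
    by (auto simp: F_def)
  then have F': "card {S \<in> F. c \<notin> S} = (?d - 1) choose ?k"
    using D c by (simp add: n_subsets)
  have F: "card F = ?d choose ?k"
    unfolding F_def by (rule n_subsets[OF D])
  have "?d * (?d choose ?k) \<le> 2 * ((?d - ?k) * (?d choose ?k))"
    by (subst mult.assoc[symmetric], rule mult_right_mono) auto
  also have "\<dots> = ?d * (2 * ((?d - 1) choose ?k))"
    by (simp add: binomial_absorb_comp)
  finally show ?thesis
    using d by (simp add: F F')
qed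

lemma nn_integral_pmf_le:
  assumes "\<And>x. x \<in> set_pmf p \<Longrightarrow> g x \<le> c"
  shows "(\<integral>\<^sup>+x. g x \<partial>measure_pmf p) \<le> c"
proof -
  have "(\<integral>\<^sup>+x. g x \<partial>measure_pmf p) \<le> (\<integral>\<^sup>+x. c \<partial>measure_pmf p)"
    using assms by (intro nn_integral_mono_AE) (auto simp: AE_measure_pmf_iff)
  then show ?thesis
    by simp
qed

text \<open>The value \<open>\<top>\<close> is for histories of probability zero.\<close>

definition potential ::
    "nat \<Rightarrow> bool list \<Rightarrow> (nat \<Rightarrow> nat) \<Rightarrow> nat \<Rightarrow> (nat \<Rightarrow> nat \<times> bool list) \<Rightarrow> ennreal" where
  "potential n z \<sigma> t h =
     (if \<not> unsolved n (\<lambda>x. real (lo n z \<sigma> x)) t h then 0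
      else if t = 0 then of_nat (n * (2 * ceillog2 n) + 2)
      else if t = 1 then (if snd (h 0) \<in> cube n then of_nat (n * (2 * ceillog2 n) + 1) else \<top>)
      else (let s = state n (\<lambda>i. real (lo n z \<sigma> (snd (h i)))) (t - 1) in
        if progress n z \<sigma> (\<lambda>i. snd (h i)) s then of_nat (cost n s) else \<top>))"

lemma unsolved_Suc:
  "unsolved n f (Suc t) h \<longleftrightarrow> unsolved n f t h \<and> \<not> maximizer n f (snd (h t))"
  by (auto simp: unsolved_def less_Suc_eq)

lemma unsolved_upd: "unsolved n f t (h(t := y)) \<longleftrightarrow> unsolved n f t h"
  by (auto simp: unsolved_def)

text \<open>The summand 2 of the initial potential pays for the random first point and its
  complement; the first unit is spent here.\<close>

lemma potential_drift_init:
  "(\<integral>\<^sup>+y. potential n z \<sigma> (Suc 0) (h(0 := y)) \<partial>measure_pmf (round_law n A f 0 h)) + 1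
    \<le> potential n z \<sigma> 0 h"
proof -
  have "cube n = {xs. set xs \<subseteq> UNIV \<and> length xs = n}" by (auto simp: cube_def)
  then have "finite (cube n)"
    using finite_lists_length_eq[of "UNIV :: bool set" n] by simp
  moreover have "cube n \<noteq> {}"
    using flip_in_cube by blast
  ultimately have "(\<integral>\<^sup>+y. potential n z \<sigma> (Suc 0) (h(0 := y)) \<partial>measure_pmf (round_law n A f 0 h))
      \<le> of_nat (n * (2 * ceillog2 n) + 1)"
    by (intro nn_integral_pmf_le) (auto simp: round_law_def potential_def)
  then have "(\<integral>\<^sup>+y. potential n z \<sigma> (Suc 0) (h(0 := y)) \<partial>measure_pmf (round_law n A f 0 h)) + 1
      \<le> of_nat (n * (2 * ceillog2 n) + 1) + 1"
    by (rule add_right_mono)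
  also have "\<dots> = of_nat (n * (2 * ceillog2 n) + 2)"
    by (simp only: of_nat_add of_nat_1 of_nat_numeral add.assoc one_add_one)
  also have "\<dots> = potential n z \<sigma> 0 h"
    by (simp add: potential_def unsolved_def)
  finally show ?thesis .
qed

text \<open>The initial state names index 0 twice, so the operator gets equal arguments and returns
  the complement with certainty. If neither point is optimal, the two form a pair for
  \<open>m = n\<close>.\<close>

lemma potential_drift_complement:
  assumes \<sigma>: "\<sigma> permutes {..<n}" and n: "2 \<le> n"
    and u: "unsolved n (\<lambda>x. real (lo n z \<sigma> x)) 1 h"
  shows "(\<integral>\<^sup>+y. potential n z \<sigma> (Suc 1) (h(1 := y))
      \<partial>measure_pmf (round_law n (searcher n) (\<lambda>x. real (lo n z \<sigma> x)) 1 h)) + 1 \<le> potential n z \<sigma> 1 h"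
proof (cases "snd (h 0) \<in> cube n")
  case True
  let ?f = "\<lambda>x. real (lo n z \<sigma> x)"
  define x where "x = snd (h 0)"
  define h' where "h' = h(1 := (0, flip n x {..<n}))"
  define p where "p i = snd (h' i)" for i
  have p: "p 0 = x" "p 1 = flip n x {..<n}" "x \<in> cube n"
    using True by (auto simp: p_def h'_def x_def)
  have "round_law n (searcher n) ?f (Suc 0) h = return_pmf (0, flip n x {..<n})"
    by (subst round_law_searcher) (auto simp: flip_sets_def pmf_of_set_singleton x_def)
  then have "(\<integral>\<^sup>+y. potential n z \<sigma> (Suc 1) (h(1 := y)) \<partial>measure_pmf (round_law n (searcher n) ?f 1 h))
      = potential n z \<sigma> (Suc 1) h'"
    by (simp add: h'_def)
  also have "\<dots> \<le> of_nat (n * (2 * ceillog2 n))"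
  proof (cases "unsolved n ?f (Suc 1) h'")
    case True
    then have "\<not> maximizer n ?f (p 0)" "\<not> maximizer n ?f (p 1)"
      by (auto simp: unsolved_def p_def)
    then have lo: "lo n z \<sigma> (p 0) < n" "lo n z \<sigma> (p 1) < n"
      using p by (auto intro!: lo_less_if_not_maximizer flip_in_cube)
    have "diff n (p 0) (p 1) = {..<n}"
      unfolding p by (auto simp: diff_def flip_nth)
    also have "\<dots> = \<sigma> ` {n - n..<n}"
      using permutes_image[OF \<sigma>] by (simp add: atLeast0LessThan)
    finally have c: "complementary n z \<sigma> n (p 0) (p 1)"
      using p(1,3) flip_in_cube[of n x "{..<n}", folded p(2)] by (simp add: complementary_def)
    have "state n (\<lambda>i. ?f (p i)) 1 = new_phase n 0 1 (?f (p 1)) n"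
      by simp
    with progress_new_phase[OF c _ \<sigma> lo] n True show ?thesis
      by (simp add: potential_def p_def Let_def flip: of_nat_mult)
  qed (simp add: potential_def)
  finally have "(\<integral>\<^sup>+y. potential n z \<sigma> (Suc 1) (h(1 := y))
      \<partial>measure_pmf (round_law n (searcher n) ?f 1 h)) + 1 \<le> of_nat (n * (2 * ceillog2 n)) + 1"
    by (rule add_right_mono)
  also have "\<dots> = of_nat (n * (2 * ceillog2 n) + 1)"
    by (simp only: of_nat_add of_nat_1)
  also have "\<dots> = potential n z \<sigma> 1 h"
    using True u by (simp add: potential_def)
  finally show ?thesis .
qed (use u in \<open>simp add: potential_def\<close>)

text \<open>With probability at least 1/2 the critical bit is spared and the cost drops by 2;
  otherwise the state does not change. The expected drop is thus at least 1.\<close>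

lemma potential_drift_search:
  assumes \<sigma>: "\<sigma> permutes {..<n}" and t: "1 \<le> t"
    and u: "unsolved n (\<lambda>x. real (lo n z \<sigma> x)) (Suc t) h"
  shows "(\<integral>\<^sup>+y. potential n z \<sigma> (Suc (Suc t)) (h(Suc t := y))
      \<partial>measure_pmf (round_law n (searcher n) (\<lambda>x. real (lo n z \<sigma> x)) (Suc t) h)) + 1
    \<le> potential n z \<sigma> (Suc t) h"
proof -
  let ?f = "\<lambda>x. real (lo n z \<sigma> x)"
  obtain a b c m d where s: "state n (\<lambda>i. ?f (snd (h i))) t = (a, b, c, m, d)"
    by (cases "state n (\<lambda>i. ?f (snd (h i))) t")
  note le = state_le[OF s]
  show ?thesis
  proof (cases "progress n z \<sigma> (\<lambda>i. snd (h i)) (a, b, c, m, d)")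
    case False
    then show ?thesis
      using t u s by (simp add: potential_def)
  next
    case True
    define v w where vw: "v = snd (h b)" "w = snd (h c)"
    define F where "F = {S. S \<subseteq> diff n v w \<and> card S = card (diff n v w) div 2}"
    define N where "N = {S. \<sigma> (n - m) \<notin> S}"
    define V where "V S = potential n z \<sigma> (Suc (Suc t)) (h(Suc t := (0, flip n v S)))" for S
    have sr: "searching n z \<sigma> (snd (h a)) v w m d"
      using True by (simp add: vw)
    then have d: "card (diff n v w) = d"
      by (simp add: searching_def)
    have crit: "\<sigma> (n - m) \<in> diff n v w"
      by (rule searching_critical[OF sr \<sigma>])
    then have ne: "v \<noteq> w"
      by (auto simp: diff_def)
    then have F_eq: "F = flip_sets n v w"
      by (simp add: F_def flip_sets_def)
    then have F: "finite F" "F \<noteq> {}"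
      by simp_all
    \<comment> \<open>Adding the gain on the left avoids subtraction in \<open>ennreal\<close>;
      integration over \<open>S\<close> then yields the drift.\<close>
    have pointwise: "V S + 2 * indicator N S \<le> of_nat (cost n (a, b, c, m, d))" if "S \<in> F" for S
    proof -
      define h' where "h' = h(Suc t := (0, flip n v S))"
      define p where "p i = snd (h' i)" for i
      have S: "S \<subseteq> diff n v w" "card S = d div 2"
        using that by (auto simp: F_def d)
      have p: "p i = snd (h i)" if "i \<le> t" for i
        using that by (simp add: p_def h'_def)
      have pt: "p (Suc t) = flip n v S"
        by (simp add: p_def h'_def)
      \<comment> \<open>The state after round \<open>t\<close> reads only values up to
        \<open>t\<close>, which the new point does not affect.\<close>
      have "state n (\<lambda>i. ?f (p i)) t = (a, b, c, m, d)"
        using s by (subst state_cong[where g'="\<lambda>i. ?f (snd (h i))"]) (auto simp: p)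
      then have st: "state n (\<lambda>i. ?f (snd (h' i))) (Suc t) =
          update n (Suc t) (?f (p (Suc t))) (a, b, c, m, d)"
        by (simp only: state.simps p_def)
      have sp: "searching n z \<sigma> (p a) (p b) (p c) m d"
        using sr le by (simp add: p vw)
      have pbc: "p b = v" "p c = w"
        using le by (simp_all add: p vw)
      show ?thesis
      proof (cases "unsolved n ?f (Suc (Suc t)) h'")
        case unsolved: True
        then have V: "V S = (if progress n z \<sigma> p (update n (Suc t) (?f (p (Suc t))) (a, b, c, m, d))
            then of_nat (cost n (update n (Suc t) (?f (p (Suc t))) (a, b, c, m, d))) else \<top>)"
          unfolding V_def potential_def h'_def[symmetric]
          using st by (simp add: p_def[abs_def] del: state.simps update.simps)
        show ?thesis
        proof (cases "S \<in> N")
          case True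
          have "\<not> maximizer n ?f (p a)" "\<not> maximizer n ?f (p (Suc t))"
            using unsolved le by (auto simp: unsolved_def p_def)
          then have lo: "lo n z \<sigma> (p a) < n" "lo n z \<sigma> (p (Suc t)) < n"
            using sp by (auto intro!: lo_less_if_not_maximizer simp: searching_def complementary_def pt flip_in_cube)
          have crit: "\<sigma> (n - m) \<notin> S"
            using True by (simp add: N_def)
          note upd = progress_update[OF sp \<sigma> _ S(2) _ crit lo, unfolded pbc, OF S(1) pt]
          have "of_nat (cost n (update n (Suc t) (?f (p (Suc t))) (a, b, c, m, d))) + 2
              \<le> (of_nat (cost n (a, b, c, m, d)) :: ennreal)"
            using of_nat_mono[OF upd(2)] by (simp only: of_nat_add of_nat_numeral)
          then show ?thesis
            using True upd(1) by (simp add: V del: update.simps cost.simps)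
        next
          case False
          then have "\<not> n - m < lo n z \<sigma> (p (Suc t))"
            using lo_flip[OF sr \<sigma> S(1)] by (simp add: N_def pt)
          moreover have "m \<le> n"
            using sr by (simp add: searching_def complementary_def)
          ultimately have "\<not> ?f (p (Suc t)) > real n - real m"
            by linarith
          then have "update n (Suc t) (?f (p (Suc t))) (a, b, c, m, d) = (a, b, c, m, d)"
            by simp
          then show ?thesis
            using False sp by (simp add: V del: update.simps cost.simps)
        qed
      next
        case False
        \<comment> \<open>If the search is over, the new potential is 0, and
          \<open>2 \<le> d\<close> leaves enough cost to cover the gain.\<close>
        have "2 \<le> cost n (a, b, c, m, d)"
          using sr ceillog2_halve[of d] by (simp add: searching_def)
        then have "(2::ennreal) \<le> of_nat (cost n (a, b, c, m, d))"
          by (metis of_nat_le_iff of_nat_numeral)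
        then show ?thesis
          using False by (simp add: V_def potential_def h'_def indicator_def del: cost.simps)
      qed
    qed
    have "card F \<le> 2 * card (F \<inter> N)"
      using card_half_subsets_le[OF finite_diff crit] by (simp add: F_def N_def Int_def)
    then have half: "1 / 2 \<le> measure (measure_pmf (pmf_of_set F)) N"
      using F by (simp add: measure_pmf_of_set field_simps card_gt_0_iff)
    have "ennreal 1 \<le> ennreal (2 * measure (measure_pmf (pmf_of_set F)) N)"
      using half by (intro ennreal_leI) simp
    also have "\<dots> = (\<integral>\<^sup>+S. 2 * indicator N S \<partial>pmf_of_set F)"
      by (simp add: nn_integral_cmult_indicator measure_pmf.emeasure_eq_measure ennreal_mult)
    finally have "1 \<le> (\<integral>\<^sup>+S. 2 * indicator N S \<partial>pmf_of_set F)"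
      by simp
    then have "(\<integral>\<^sup>+S. V S \<partial>pmf_of_set F) + 1 \<le>
        (\<integral>\<^sup>+S. V S \<partial>pmf_of_set F) + (\<integral>\<^sup>+S. 2 * indicator N S \<partial>pmf_of_set F)"
      by (rule add_left_mono)
    also have "\<dots> = (\<integral>\<^sup>+S. V S + 2 * indicator N S \<partial>pmf_of_set F)"
      by (simp add: nn_integral_add)
    also have "\<dots> \<le> of_nat (cost n (a, b, c, m, d))"
      using F pointwise by (intro nn_integral_pmf_le) simp
    also have "\<dots> = potential n z \<sigma> (Suc t) h"
      using True t u s by (simp add: potential_def)
    finally show ?thesis
      by (simp add: round_law_searcher[OF s] F_eq V_def vw)
  qed
qed

section \<open>The resulting \<open>O(n log n)\<close> bound\<close>

lemma expected_queries_searcher: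
  assumes \<sigma>: "\<sigma> permutes {..<n}" and n: "2 \<le> n"
  shows "expected_queries n (searcher n) (\<lambda>x. real (lo n z \<sigma> x)) \<le> of_nat (n * (2 * ceillog2 n) + 2)"
proof -
  let ?f = "\<lambda>x. real (lo n z \<sigma> x)"
  have "expected_queries n (searcher n) ?f \<le> potential n z \<sigma> 0 (\<lambda>_. undefined)"
  proof (rule expected_queries_le)
    fix t and h :: "nat \<Rightarrow> nat \<times> bool list"
    show "(\<integral>\<^sup>+y. potential n z \<sigma> (Suc t) (h(t := y)) \<partial>measure_pmf (round_law n (searcher n) ?f t h)) +
        indicator {h. unsolved n ?f t h} h \<le> potential n z \<sigma> t h"
    proof (cases "unsolved n ?f t h")
      case True
      consider "t = 0" | "t = 1" | t' where "t = Suc t'" "1 \<le> t'"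
        by (cases t) (auto simp: Suc_le_eq)
      then show ?thesis
        using True potential_drift_init[where n=n and z=z and \<sigma>=\<sigma> and h=h and A="searcher n" and f="?f"]
          potential_drift_complement[OF \<sigma> n, of z h] potential_drift_search[OF \<sigma>, of _ z h]
        by cases simp_all
    next
      case False
      \<comment> \<open>Once a maximizer has been queried, the potential stays 0.\<close>
      then have "potential n z \<sigma> (Suc t) (h(t := y)) = 0" for y
        by (simp add: potential_def unsolved_Suc unsolved_upd)
      with False show ?thesis
        by simp
    qed
  qed
  also have "\<dots> = of_nat (n * (2 * ceillog2 n) + 2)"
    by (simp add: potential_def unsolved_def)
  finally show ?thesis .
qed

theorem theorem14:
  shows "\<exists>C::real. \<forall>n\<ge>2.
    unbiased_complexity n 2 (LeadingOnes n) \<le> ennreal (C * (real n * ln (real n)))"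
proof (intro exI allI impI)
  fix n :: nat assume n: "2 \<le> n"
  \<comment> \<open>Since \<open>log 2 n \<ge> 1\<close>, the rounding in \<open>ceillog2 n\<close>
    costs at most a factor 2 and the additive 2 at most one more \<open>n * log 2 n\<close>: 4 + 1 =
    5, and \<open>1 / ln 2\<close> changes the base.\<close>
  have "1 \<le> log 2 (real n)"
    using n by simp
  moreover have "real (ceillog2 n) \<le> log 2 (real n) + 1"
    using ceillog2_less_log[of n] n by simp
  ultimately have "real (ceillog2 n) \<le> 2 * log 2 (real n)"
    by linarith
  then have "real n * (2 * real (ceillog2 n)) \<le> real n * (4 * log 2 (real n))"
    by (intro mult_left_mono) auto
  moreover have "2 * 1 \<le> real n * log 2 (real n)"
    using n \<open>1 \<le> log 2 (real n)\<close> by (intro mult_mono) auto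
  ultimately have "real (n * (2 * ceillog2 n) + 2) \<le> 5 * (real n * log 2 (real n))"
    by simp
  also have "\<dots> = 5 / ln 2 * (real n * ln (real n))"
    by (simp add: log_def)
  finally have bound: "of_nat (n * (2 * ceillog2 n) + 2) \<le> ennreal (5 / ln 2 * (real n * ln (real n)))"
    unfolding ennreal_of_nat_eq_real_of_nat by (rule ennreal_leI)
  have "unbiased_complexity n 2 (LeadingOnes n) \<le> (SUP f\<in>LeadingOnes n. expected_queries n (searcher n) f)"
    unfolding unbiased_complexity_def by (rule INF_lower) (simp add: unbiased_searcher)
  also have "\<dots> \<le> of_nat (n * (2 * ceillog2 n) + 2)"
    by (rule SUP_least) (auto simp: LeadingOnes_def intro: expected_queries_searcher[OF _ n, simplified])
  also note bound
  finally show "unbiased_complexity n 2 (LeadingOnes n) \<le> ennreal (5 / ln 2 * (real n * ln (real n)))" .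
qed

end
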